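(* For all integers $n\ge 0$ and $i \geq 0$ and all real $x$, the $i$-th derivatives of the Cauchy polynomials can be expressed by $$\frac{d^i c_n(x)}{d x^i} = i! \sum_{m=i}^n (-1)^m c_{n-m} \binom{n}{m} \genfrac{[}{]}{0pt}{}{m}{i}_x$$ and $$\frac{d^i \widehat{c}_n(x)}{d x^i} = (-1)^i i! \sum_{m=i}^n (-1)^m \, \widehat{c}_{n-m} \binom{n}{m}\genfrac{[}{]}{0pt}{}{m}{i}_{-x}.$$
   Context: For real $z$ and integer $n\ge 0$, $\binom{z}{n} = \frac{z(z-1)\cdots(z-n+1)}{n!}$. The Cauchy polynomials of the first and second kind are $c_n(x) = n! \int_{0}^{1} \binom{t - x}{n}\, dt$ and $\widehat{c}_n(x) = n! \int_{0}^{1} \binom{x - t}{n}\, dt$, $n \ge 0$; the Cauchy numbers are $c_n = c_n(0)$ and $\widehat{c}_n=\widehat{c}_n(0)$. The generalized Stirling numbers of the first kind are $\genfrac{[}{]}{0pt}{}{n}{m}_x = \sum_{i=0}^{n-m} \binom{i+m}{m}\genfrac{[}{]}{0pt}{}{n}{i+m} x^i$ for $0 \leq m \leq n$ and $x\in\mathbb{R}$, where $\genfrac{[}{]}{0pt}{}{n}{m}$ are the unsigned Stirling numbers of the first kind and $x^0=1$. Empty sums (when $i>n$) are $0$. *)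

theory Defs
  imports "HOL-Analysis.Analysis" "HOL-Combinatorics.Stirling"
begin

definition cauchy_poly1 :: "nat \<Rightarrow> real \<Rightarrow> real" where
  "cauchy_poly1 n x = fact n * integral {0..1} (\<lambda>t. (t - x) gchoose n)"

definition cauchy_poly2 :: "nat \<Rightarrow> real \<Rightarrow> real" where
  "cauchy_poly2 n x = fact n * integral {0..1} (\<lambda>t. (x - t) gchoose n)"

definition cauchy_num1 :: "nat \<Rightarrow> real" where
  "cauchy_num1 n = cauchy_poly1 n 0"

definition cauchy_num2 :: "nat \<Rightarrow> real" where
  "cauchy_num2 n = cauchy_poly2 n 0"

(* Meant for m \<le> n; the library constant stirling is the unsigned Stirling
   number of the first kind. For m > n the truncated difference leaves the
   single term stirling n m = 0. *)
definition gen_stirling :: "nat \<Rightarrow> nat \<Rightarrow> real \<Rightarrow> real" where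
  "gen_stirling n m x =
     (\<Sum>i = 0..n - m. real ((i + m) choose m) * real (stirling n (i + m)) * x ^ i)"

end

theory Submission
  imports Defs
begin

text \<open>
  Vandermonde's identity expands both Cauchy polynomials in the rising factorials of \<open>x\<close> and
  \<open>- x\<close>, respectively, with the Cauchy numbers as coefficients. The rising factorial of degree
  \<open>m\<close> is the generating polynomial of the Stirling numbers, so its \<open>i\<close>-th Taylor
  coefficient at \<open>x\<close> is \<open>gen_stirling m i x\<close>.
\<close>

text \<open>The substitution \<open>k = i + m\<close> makes the range of summation independent of
  \<open>m\<close>, so it stays fixed under differentiation. The added terms with
  \<open>k < m\<close> vanish because \<open>k choose m = 0\<close>.\<close>

lemma gen_stirling_altdef:
  "gen_stirling n m x = (\<Sum>k\<le>n. real (k choose m) * real (stirling n k) * x ^ (k - m))"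
proof (cases "m \<le> n")
  case True
  have "(\<Sum>k\<le>n. real (k choose m) * real (stirling n k) * x ^ (k - m)) =
        (\<Sum>k\<in>{m..n}. real (k choose m) * real (stirling n k) * x ^ (k - m))"
    by (rule sum.mono_neutral_right) auto
  also have "\<dots> = gen_stirling n m x"
    unfolding gen_stirling_def using True
    by (intro sum.reindex_bij_witness[of _ "\<lambda>j. j + m" "\<lambda>k. k - m"]) auto
  finally show ?thesis ..
next
  case False
  then show ?thesis by (auto simp: gen_stirling_def intro: sum.neutral)
qed

lemma gen_stirling_0: "gen_stirling n 0 x = pochhammer x n"
  by (simp add: gen_stirling_altdef stirling_pochhammer)

lemma gen_stirling_eq_0: "n < m \<Longrightarrow> gen_stirling n m x = 0"
  unfolding gen_stirling_altdef by (rule sum.neutral) auto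

lemma has_real_derivative_gen_stirling:
  "(gen_stirling n m has_real_derivative real (Suc m) * gen_stirling n (Suc m) x) (at x)"
proof -
  \<comment> \<open>Absorption turns the exponent brought down by differentiation into a shift of
    the lower index. For \<open>k < m\<close> the binomial coefficients on both sides are 0.\<close>
  have *: "real (k choose m) * real (k - m) = real (Suc m) * real (k choose Suc m)" for k
  proof (cases "m \<le> k")
    case True
    have "Suc m * (k choose Suc m) = (k - m) * (k choose m)"
      using binomial_absorption[of m k] binomial_absorb_comp[of k m] by simp
    then show ?thesis by (metis of_nat_mult mult.commute)
  qed simp
  have "((\<lambda>x. \<Sum>k\<le>n. real (k choose m) * real (stirling n k) * x ^ (k - m)) has_real_derivative
         (\<Sum>k\<le>n. real (k choose m) * real (stirling n k) * (real (k - m) * x ^ (k - Suc m)))) (at x)"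
    by (auto intro!: derivative_eq_intros sum.cong simp: mult_ac)
  moreover have "(\<Sum>k\<le>n. real (k choose m) * real (stirling n k) * (real (k - m) * x ^ (k - Suc m)))
      = (\<Sum>k\<le>n. (real (k choose m) * real (k - m)) * (real (stirling n k) * x ^ (k - Suc m)))"
    by (simp only: mult_ac)
  ultimately show ?thesis
    unfolding gen_stirling_altdef[abs_def] * by (simp only: sum_distrib_left mult_ac)
qed

text \<open>The scale \<open>c\<close> covers both kinds at once, with values 1 and -1; each
  application of the chain rule contributes one factor \<open>c\<close>.\<close>

lemma higher_deriv_sum_pochhammer:
  fixes a :: "nat \<Rightarrow> real" and c :: real
  shows "(deriv ^^ i) (\<lambda>x. \<Sum>m\<le>n. a m * pochhammer (c * x) m) =
         (\<lambda>x. c ^ i * fact i * (\<Sum>m = i..n. a m * gen_stirling m i (c * x)))"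
proof -
  \<comment> \<open>The induction runs over the full range \<open>m \<le> n\<close>, which does not
    move with \<open>i\<close>; the terms with \<open>m < i\<close> are zero and are dropped
    afterwards.\<close>
  have "(deriv ^^ i) (\<lambda>x. \<Sum>m\<le>n. a m * pochhammer (c * x) m) =
        (\<lambda>x. c ^ i * fact i * (\<Sum>m\<le>n. a m * gen_stirling m i (c * x)))"
  proof (induction i)
    case 0
    show ?case by (simp add: gen_stirling_0)
  next
    case (Suc i)
    have "((\<lambda>x. gen_stirling m i (c * x)) has_real_derivative
            real (Suc i) * gen_stirling m (Suc i) (c * x) * c) (at x)" for m x
      by (rule DERIV_chain2[OF has_real_derivative_gen_stirling])
        (auto intro!: derivative_eq_intros)
    then have "((\<lambda>x. c ^ i * fact i * (\<Sum>m\<le>n. a m * gen_stirling m i (c * x))) has_real_derivative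
        c ^ i * fact i * (\<Sum>m\<le>n. a m * (real (Suc i) * gen_stirling m (Suc i) (c * x) * c))) (at x)"
      for x
      by (intro DERIV_cmult DERIV_sum) auto
    then have "deriv (\<lambda>x. c ^ i * fact i * (\<Sum>m\<le>n. a m * gen_stirling m i (c * x))) x =
        c ^ i * fact i * (\<Sum>m\<le>n. a m * (real (Suc i) * gen_stirling m (Suc i) (c * x) * c))" for x
      by (rule DERIV_imp_deriv)
    then show ?case
      unfolding funpow.simps o_apply Suc.IH
      by (simp only: fact_Suc power_Suc of_nat_mult sum_distrib_left mult_ac)
  qed
  moreover have "(\<Sum>m\<le>n. a m * gen_stirling m i (c * x)) = (\<Sum>m = i..n. a m * gen_stirling m i (c * x))"
    for x
    by (rule sum.mono_neutral_right) (auto simp: gen_stirling_eq_0)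
  ultimately show ?thesis by simp
qed

text \<open>In Vandermonde's convolution, \<open>n! = m! (n - m)! (n choose m)\<close> gives each
  factor its own factorial; \<open>m! (z gchoose m)\<close> is a falling factorial of
  \<open>z\<close>, that is, a signed rising factorial of \<open>- z\<close>.\<close>

lemma fact_gbinomial_add:
  fixes y z :: real
  shows "fact n * ((y + z) gchoose n) =
    (\<Sum>m\<le>n. (- 1) ^ m * real (n choose m) * pochhammer (- z) m * (fact (n - m) * (y gchoose (n - m))))"
proof -
  have "fact n * ((y + z) gchoose n) = (\<Sum>m\<le>n. fact n * ((z gchoose m) * (y gchoose (n - m))))"
    using gbinomial_Vandermonde[of z y n]
    by (simp add: sum_distrib_left[symmetric] atLeast0AtMost add.commute)
  also have "\<dots> = (\<Sum>m\<le>n. (- 1) ^ m * real (n choose m) * pochhammer (- z) m *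
                         (fact (n - m) * (y gchoose (n - m))))"
  proof (rule sum.cong)
    fix m assume "m \<in> {..n}"
    then have "(fact n :: real) = fact m * fact (n - m) * real (n choose m)"
      by (simp add: binomial_fact)
    then show "fact n * ((z gchoose m) * (y gchoose (n - m))) =
        (- 1) ^ m * real (n choose m) * pochhammer (- z) m * (fact (n - m) * (y gchoose (n - m)))"
      by (simp add: gbinomial_pochhammer[of z m])
  qed simp
  finally show ?thesis .
qed

text \<open>Only the factors in \<open>g t\<close> depend on \<open>t\<close>. For
  \<open>g t = t\<close> and \<open>g t = - t\<close> their integrals are the Cauchy numbers of the
  two kinds.\<close>

lemma fact_integral_gbinomial_add:
  fixes g :: "real \<Rightarrow> real" and z :: real
  assumes "continuous_on {0..1} g"
  shows "fact n * integral {0..1} (\<lambda>t. (g t + z) gchoose n) =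
    (\<Sum>m\<le>n. (- 1) ^ m * (fact (n - m) * integral {0..1} (\<lambda>t. g t gchoose (n - m)))
              * real (n choose m) * pochhammer (- z) m)"
proof -
  \<comment> \<open>As a polynomial in \<open>g t\<close>, the integrand is continuous.\<close>
  have "(\<lambda>t. g t gchoose k) integrable_on {0..1}" for k
    unfolding gbinomial_prod_rev
    by (intro integrable_continuous_real continuous_intros assms) auto
  then have "integral {0..1} (\<lambda>t. fact n * ((g t + z) gchoose n)) =
    (\<Sum>m\<le>n. integral {0..1} (\<lambda>t. (- 1) ^ m * real (n choose m) * pochhammer (- z) m *
                         (fact (n - m) * (g t gchoose (n - m)))))"
    unfolding fact_gbinomial_add by (intro integral_sum integrable_on_mult_right) auto
  then show ?thesis by (simp add: mult_ac)
qed

lemma cauchy_poly1_eq_sum_pochhammer: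
  "cauchy_poly1 n x =
    (\<Sum>m\<le>n. ((- 1) ^ m * cauchy_num1 (n - m) * real (n choose m)) * pochhammer x m)"
  using fact_integral_gbinomial_add[of "\<lambda>t. t" n "- x"]
  by (simp add: cauchy_num1_def cauchy_poly1_def)

lemma cauchy_poly2_eq_sum_pochhammer:
  "cauchy_poly2 n x =
    (\<Sum>m\<le>n. ((- 1) ^ m * cauchy_num2 (n - m) * real (n choose m)) * pochhammer (- x) m)"
  using fact_integral_gbinomial_add[of "\<lambda>t. - t" n x]
  by (simp add: cauchy_num2_def cauchy_poly2_def continuous_on_minus)

theorem theorem6:
  fixes n i :: nat and x :: real
  shows "(deriv ^^ i) (cauchy_poly1 n) x =
           fact i * (\<Sum>m = i..n. (-1) ^ m * cauchy_num1 (n - m) * real (n choose m) * gen_stirling m i x)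
       \<and> (deriv ^^ i) (cauchy_poly2 n) x =
           (-1) ^ i * fact i *
             (\<Sum>m = i..n. (-1) ^ m * cauchy_num2 (n - m) * real (n choose m) * gen_stirling m i (- x))"
  \<comment> \<open>The open argument is the coefficient sequence, supplied by the two expansions in
    rising factorials.\<close>
  using higher_deriv_sum_pochhammer[of i _ 1 n] higher_deriv_sum_pochhammer[of i _ "- 1" n]
  by (simp add: cauchy_poly1_eq_sum_pochhammer[abs_def] cauchy_poly2_eq_sum_pochhammer[abs_def])

end
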